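(* Let $\nu>0$, $\lambda>0$, $\alpha\ge 0$. Let $f\in C(\mathbb R,\ell_2)$ be almost periodic. Let $F\in C(\mathbb R,\mathbb R)$ be Lipschitz continuous on bounded sets with $F(0)=0$, and suppose that $$(x_1-x_2)(F(x_1)-F(x_2))\le -\alpha|x_1-x_2|^2\qquad\text{for all }x_1,x_2\in\mathbb R.$$ Let $\langle\ell_2,\varphi,(H(f),\mathbb R,\sigma)\rangle$ be the cocycle generated by the equation $u'=\nu\Lambda u-\lambda u+\widetilde F(u)+f(t)$. Then there exists a unique invariant section $\gamma:H(f)\to\ell_2$ of the cocycle $\varphi$, and $$\|\varphi(t,v,g)-\gamma(\sigma(t,g))\|\le e^{-(\lambda+\alpha)t}\|v-\gamma(g)\|$$ for all $t\in\mathbb R_+$, $v\in\ell_2$ and $g\in H(f)$.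
   Context: $\ell_2$ is the Hilbert space of real two-sided square-summable sequences $(\xi_i)_{i\in\mathbb Z}$ with $\langle\xi,\eta\rangle=\sum_{i\in\mathbb Z}\xi_i\eta_i$ and norm $\|\xi\|^2=\langle\xi,\xi\rangle$; $\mathbb R_+=[0,\infty)$. The discrete Laplacian $\Lambda:\ell_2\to\ell_2$ is $(\Lambda u)_i=u_{i-1}-2u_i+u_{i+1}$. The Nemytskii operator $\widetilde F:\ell_2\to\ell_2$ is $\widetilde F(\xi)_i=F(\xi_i)$ (well defined because $F$ is locally Lipschitz and $F(0)=0$). A set $A\subset\mathbb R$ is relatively dense if there is $l>0$ with $A\cap[a,a+l]\neq\emptyset$ for all $a\in\mathbb R$. A function $f\in C(\mathbb R,\ell_2)$ is almost periodic if for every $\varepsilon>0$ the set $\{\tau\in\mathbb R:\ \|f(t+\tau)-f(t)\|<\varepsilon\ \forall t\in\mathbb R\}$ is relatively dense. $C(\mathbb R,\ell_2)$ carries the compact-open topology (uniform convergence on compact intervals). For $g\in C(\mathbb R,\ell_2)$ and $h\in\mathbb R$, $\sigma(h,g)=g^h$ with $g^h(t)=g(t+h)$. $H(f)$ is the closure of $\{f^h: h\in\mathbb R\}$ in $C(\mathbb R,\ell_2)$. Under the hypotheses it is known that for every $(v,g)\in\ell_2\times H(f)$ the equation $u'=\nu\Lambda u-\lambda u+\widetilde F(u)+g(t)$ has a unique solution $\varphi(t,v,g)$ on $\mathbb R_+$ with $\varphi(0,v,g)=v$; the map $\varphi:\mathbb R_+\times\ell_2\times H(f)\to\ell_2$ is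 continuous and $\varphi(t+\tau,v,g)=\varphi(t,\varphi(\tau,v,g),g^\tau)$. This $\varphi$ is the cocycle generated by the equation. An invariant section of the cocycle $\varphi$ is a continuous map $\gamma:H(f)\to\ell_2$ such that $\varphi(t,\gamma(g),g)=\gamma(\sigma(t,g))$ for all $t\in\mathbb R_+$ and $g\in H(f)$. *)

theory Defs
  imports "HOL-Analysis.Analysis"
begin

definition square_summable :: "(int \<Rightarrow> real) \<Rightarrow> bool" where
  "square_summable x \<longleftrightarrow> (\<lambda>i. (x i)\<^sup>2) summable_on UNIV"

lemma square_summable_zero: "square_summable (\<lambda>i. 0)"
  by (simp add: square_summable_def)

lemma square_summable_add:
  assumes "square_summable x" "square_summable y"
  shows "square_summable (\<lambda>i. x i + y i)"
  unfolding square_summable_def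
proof (rule summable_on_comparison_test)
  show "(\<lambda>i. 2 * (x i)\<^sup>2 + 2 * (y i)\<^sup>2) summable_on UNIV"
    using assms unfolding square_summable_def
    by (intro summable_on_add summable_on_cmult_right)
  fix i show "(x i + y i)\<^sup>2 \<le> 2 * (x i)\<^sup>2 + 2 * (y i)\<^sup>2"
    using zero_le_power2[of "x i - y i"] by (simp add: power2_sum power2_diff)
qed auto

lemma square_summable_scale: "square_summable x \<Longrightarrow> square_summable (\<lambda>i. c * x i)"
  unfolding square_summable_def by (simp add: power_mult_distrib summable_on_cmult_right)

lemma square_summable_uminus: "square_summable x \<Longrightarrow> square_summable (\<lambda>i. - x i)"
  unfolding square_summable_def by simp

lemma square_summable_diff:
  "square_summable x \<Longrightarrow> square_summable y \<Longrightarrow> square_summable (\<lambda>i. x i - y i)"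
  using square_summable_add[OF _ square_summable_uminus, of x y] by simp

lemma square_summable_shift:
  assumes "square_summable x"
  shows "square_summable (\<lambda>i. x (i + k))"
proof -
  have "bij_betw (\<lambda>i::int. i + k) UNIV UNIV"
    by (rule bij_betwI[of _ _ _ "\<lambda>i. i - k"]) auto
  from summable_on_reindex_bij_betw[OF this, of "\<lambda>i. (x i)\<^sup>2"] assms
  show ?thesis unfolding square_summable_def by simp
qed

lemma square_summable_mult:
  assumes "square_summable x" "square_summable y"
  shows "(\<lambda>i. x i * y i) summable_on UNIV"
proof (rule abs_summable_summable, rule summable_on_comparison_test)
  show "(\<lambda>i. (x i)\<^sup>2 + (y i)\<^sup>2) summable_on UNIV"
    using assms unfolding square_summable_def by (rule summable_on_add)
  fix i show "norm (x i * y i) \<le> (x i)\<^sup>2 + (y i)\<^sup>2"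
    using zero_le_power2[of "\<bar>x i\<bar> - \<bar>y i\<bar>"] zero_le_power2[of "x i"] zero_le_power2[of "y i"]
    unfolding power2_diff abs_mult real_norm_def power2_abs
    using mult_nonneg_nonneg[of "\<bar>x i\<bar>" "\<bar>y i\<bar>"] by linarith
qed auto

typedef ell2 = "{x. square_summable x}"
  morphisms coord Ell2
  using square_summable_zero by blast

setup_lifting type_definition_ell2

lemma square_summable_coord: "square_summable (coord x)"
  using coord by simp

lemma ell2_eqI: "(\<And>i. coord x i = coord y i) \<Longrightarrow> x = y"
  by (simp add: coord_inject[symmetric] ext)

instantiation ell2 :: real_inner
begin

lift_definition zero_ell2 :: ell2 is "\<lambda>i. 0"
  by (rule square_summable_zero)
lift_definition plus_ell2 :: "ell2 \<Rightarrow> ell2 \<Rightarrow> ell2" is "\<lambda>x y i. x i + y i"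
  by (rule square_summable_add)
lift_definition minus_ell2 :: "ell2 \<Rightarrow> ell2 \<Rightarrow> ell2" is "\<lambda>x y i. x i - y i"
  by (rule square_summable_diff)
lift_definition uminus_ell2 :: "ell2 \<Rightarrow> ell2" is "\<lambda>x i. - x i"
  by (rule square_summable_uminus)
lift_definition scaleR_ell2 :: "real \<Rightarrow> ell2 \<Rightarrow> ell2" is "\<lambda>c x i. c * x i"
  by (rule square_summable_scale)

definition inner_ell2 :: "ell2 \<Rightarrow> ell2 \<Rightarrow> real" where
  "inner_ell2 x y = (\<Sum>\<^sub>\<infinity>i\<in>UNIV. coord x i * coord y i)"
definition norm_ell2 :: "ell2 \<Rightarrow> real" where
  "norm_ell2 x = sqrt (inner x x)"
definition dist_ell2 :: "ell2 \<Rightarrow> ell2 \<Rightarrow> real" where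
  "dist_ell2 x y = norm (x - y)"
definition sgn_ell2 :: "ell2 \<Rightarrow> ell2" where
  "sgn_ell2 x = inverse (norm x) *\<^sub>R x"
definition uniformity_ell2 :: "(ell2 \<times> ell2) filter" where
  "uniformity_ell2 = (INF e\<in>{0 <..}. principal {(x, y). dist x y < e})"
definition open_ell2 :: "ell2 set \<Rightarrow> bool" where
  "open_ell2 U \<longleftrightarrow> (\<forall>x\<in>U. eventually (\<lambda>(x', y). x' = x \<longrightarrow> y \<in> U) uniformity)"

instance
proof
  fix x y z :: ell2 and a b :: real
  show "x + y + z = x + (y + z)" by transfer (simp add: add.assoc)
  show "x + y = y + x" by transfer (simp add: add.commute)
  show "0 + x = x" by transfer simp
  show "- x + x = 0" by transfer simp
  show "x - y = x + - y" by transfer simp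
  show "a *\<^sub>R (x + y) = a *\<^sub>R x + a *\<^sub>R y" by transfer (simp add: distrib_left)
  show "(a + b) *\<^sub>R x = a *\<^sub>R x + b *\<^sub>R x" by transfer (simp add: distrib_right)
  show "a *\<^sub>R b *\<^sub>R x = (a * b) *\<^sub>R x" by transfer (simp add: mult.assoc)
  show "1 *\<^sub>R x = x" by transfer simp
  show "dist x y = norm (x - y)" by (rule dist_ell2_def)
  show "sgn x = inverse (norm x) *\<^sub>R x" by (rule sgn_ell2_def)
  show "uniformity = (INF e\<in>{0 <..}. principal {(x::ell2, y). dist x y < e})"
    by (rule uniformity_ell2_def)
  show "open U = (\<forall>x\<in>U. \<forall>\<^sub>F (x', y) in uniformity. x' = x \<longrightarrow> y \<in> U)" for U :: "ell2 set"
    by (rule open_ell2_def)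
  show "inner x y = inner y x" by (simp add: inner_ell2_def mult.commute)
  show "inner (x + y) z = inner x z + inner y z"
    unfolding inner_ell2_def plus_ell2.rep_eq distrib_right
    by (intro infsum_add square_summable_mult square_summable_coord)
  show "inner (a *\<^sub>R x) y = a * inner x y"
    unfolding inner_ell2_def scaleR_ell2.rep_eq mult.assoc
    by (rule infsum_cmult_right) (intro square_summable_mult square_summable_coord)
  show "0 \<le> inner x x" unfolding inner_ell2_def by (rule infsum_nonneg) simp
  show "inner x x = 0 \<longleftrightarrow> x = 0"
  proof
    assume "inner x x = 0"
    then have le: "(\<Sum>\<^sub>\<infinity>i\<in>UNIV. coord x i * coord x i) \<le> 0"
      by (simp add: inner_ell2_def)
    have "coord x i * coord x i = 0" for i
      by (rule nonneg_infsum_le_0D[OF le])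
         (simp_all add: square_summable_mult square_summable_coord)
    then show "x = 0" by (intro ell2_eqI) (simp add: zero_ell2.rep_eq)
  qed (simp add: inner_ell2_def zero_ell2.rep_eq)
  show "norm x = sqrt (inner x x)" by (rule norm_ell2_def)
qed

end

lemma norm_ell2_sq: "(norm (x::ell2))\<^sup>2 = (\<Sum>\<^sub>\<infinity>i\<in>UNIV. (coord x i)\<^sup>2)"
  unfolding power2_norm_eq_inner inner_ell2_def by (simp only: power2_eq_square)

lemma sum_coord_le_norm_sq: "finite A \<Longrightarrow> (\<Sum>i\<in>A. (coord x i)\<^sup>2) \<le> (norm x)\<^sup>2"
  unfolding norm_ell2_sq using square_summable_coord[of x]
  by (intro finite_sum_le_infsum) (auto simp: square_summable_def)

lemma abs_coord_le_norm: "\<bar>coord x i\<bar> \<le> norm x"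
  using sum_coord_le_norm_sq[of "{i}" x] by (simp add: abs_le_square_iff[of "coord x i" "norm x", simplified])

instance ell2 :: complete_space
proof
  fix X :: "nat \<Rightarrow> ell2" assume X: "Cauchy X"
  have "Cauchy (\<lambda>n. coord (X n) i)" for i
  proof (rule metric_CauchyI)
    fix e :: real assume "e > 0"
    then obtain M where M: "\<forall>m\<ge>M. \<forall>n\<ge>M. dist (X m) (X n) < e"
      using X unfolding Cauchy_def by blast
    have "dist (coord (X m) i) (coord (X n) i) \<le> dist (X m) (X n)" for m n
      using abs_coord_le_norm[of "X m - X n" i]
      by (simp add: dist_norm minus_ell2.rep_eq)
    then show "\<exists>M. \<forall>m\<ge>M. \<forall>n\<ge>M. dist (coord (X m) i) (coord (X n) i) < e"
      using M by (meson le_less_trans)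
  qed
  then have "\<forall>i. \<exists>l. (\<lambda>n. coord (X n) i) \<longlonglongrightarrow> l"
    using Cauchy_convergent convergent_def by blast
  then obtain y where y: "\<And>i. (\<lambda>n. coord (X n) i) \<longlonglongrightarrow> y i"
    by metis
  have key: "\<exists>N. \<forall>n\<ge>N. \<forall>A. finite A \<longrightarrow> (\<Sum>i\<in>A. (coord (X n) i - y i)\<^sup>2) \<le> e\<^sup>2"
    if e: "e > 0" for e
  proof -
    obtain N where N: "\<And>m n. m \<ge> N \<Longrightarrow> n \<ge> N \<Longrightarrow> dist (X m) (X n) < e"
      using X e unfolding Cauchy_def by meson
    have "(\<Sum>i\<in>A. (coord (X n) i - y i)\<^sup>2) \<le> e\<^sup>2" if n: "n \<ge> N" and A: "finite A" for n A
    proof (rule tendsto_upperbound)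
      show "(\<lambda>m. \<Sum>i\<in>A. (coord (X n) i - coord (X m) i)\<^sup>2)
              \<longlonglongrightarrow> (\<Sum>i\<in>A. (coord (X n) i - y i)\<^sup>2)"
        by (intro tendsto_intros y)
      show "\<forall>\<^sub>F m in sequentially. (\<Sum>i\<in>A. (coord (X n) i - coord (X m) i)\<^sup>2) \<le> e\<^sup>2"
        using eventually_ge_at_top[of N]
      proof eventually_elim
        case (elim m)
        have "(\<Sum>i\<in>A. (coord (X n) i - coord (X m) i)\<^sup>2) \<le> (norm (X n - X m))\<^sup>2"
          using sum_coord_le_norm_sq[OF A, of "X n - X m"] by (simp add: minus_ell2.rep_eq)
        also have "\<dots> \<le> e\<^sup>2"
          using N[OF n elim] by (intro power_mono) (auto simp: dist_norm)
        finally show ?case .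
      qed
    qed simp
    then show ?thesis by blast
  qed
  have summ: "square_summable (\<lambda>i. coord (X n) i - y i)"
    if "\<forall>A. finite A \<longrightarrow> (\<Sum>i\<in>A. (coord (X n) i - y i)\<^sup>2) \<le> e\<^sup>2" for n e
    unfolding square_summable_def
    by (rule nonneg_bdd_above_summable_on) (use that in \<open>auto intro!: bdd_aboveI[of _ "e\<^sup>2"]\<close>)
  obtain N where "square_summable (\<lambda>i. coord (X N) i - y i)"
    using key[of 1] summ[of _ 1] by auto
  from square_summable_diff[OF square_summable_coord[of "X N"] this]
  have y2: "coord (Ell2 y) = y" by (simp add: Ell2_inverse)
  have "X \<longlonglongrightarrow> Ell2 y"
  proof (rule LIMSEQ_I)
    fix r :: real assume "r > 0"
    then obtain N where N: "\<forall>n\<ge>N. \<forall>A. finite A \<longrightarrow> (\<Sum>i\<in>A. (coord (X n) i - y i)\<^sup>2) \<le> (r/2)\<^sup>2"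
      using key[of "r/2"] by auto
    have "norm (X n - Ell2 y) < r" if "n \<ge> N" for n
    proof -
      have "(norm (X n - Ell2 y))\<^sup>2 \<le> (r/2)\<^sup>2"
        unfolding norm_ell2_sq minus_ell2.rep_eq y2
        using summ[of n "r/2"] N that
        by (intro infsum_le_finite_sums) (auto simp: square_summable_def)
      then have "norm (X n - Ell2 y) \<le> r/2"
        using \<open>r > 0\<close> by (simp add: power2_le_iff_abs_le)
      then show ?thesis using \<open>r > 0\<close> by simp
    qed
    then show "\<exists>no. \<forall>n\<ge>no. norm (X n - Ell2 y) < r" by blast
  qed
  then show "convergent X" by (rule convergentI)
qed

lift_definition laplacian :: "ell2 \<Rightarrow> ell2" is "\<lambda>u i. u (i - 1) - 2 * u i + u (i + 1)"
  using square_summable_shift[of _ 1] square_summable_shift[of _ "-1"]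
  by (auto intro!: square_summable_add square_summable_diff square_summable_scale)

definition lipschitz_on_bounded_sets :: "(real \<Rightarrow> real) \<Rightarrow> bool" where
  "lipschitz_on_bounded_sets F \<longleftrightarrow> (\<forall>S. bounded S \<longrightarrow> (\<exists>L. L-lipschitz_on S F))"

text \<open>Meaningful only when \<open>F\<close> maps square-summable sequences to square-summable ones;
  see \<open>coord_nemytskii\<close>.\<close>

definition nemytskii :: "(real \<Rightarrow> real) \<Rightarrow> ell2 \<Rightarrow> ell2" where
  "nemytskii F x = Ell2 (\<lambda>i. F (coord x i))"

lemma coord_nemytskii:
  assumes "lipschitz_on_bounded_sets F" "F 0 = 0"
  shows "coord (nemytskii F x) i = F (coord x i)"
proof -
  obtain L where L: "L-lipschitz_on {- norm x..norm x} F"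
    using assms(1) unfolding lipschitz_on_bounded_sets_def by (meson bounded_closed_interval)
  have le: "(F (coord x i))\<^sup>2 \<le> L\<^sup>2 * (coord x i)\<^sup>2" for i
  proof -
    have "\<bar>F (coord x i)\<bar> \<le> L * \<bar>coord x i\<bar>"
      using lipschitz_onD[OF L, of "coord x i" 0] abs_coord_le_norm[of x i] assms(2)
      by (auto simp: dist_real_def abs_le_iff minus_le_iff)
    from power_mono[OF this, of 2] show ?thesis by (simp add: power_mult_distrib)
  qed
  have summ: "(\<lambda>i. L\<^sup>2 * (coord x i)\<^sup>2) summable_on UNIV"
    using square_summable_coord[of x]
    unfolding square_summable_def by (rule summable_on_cmult_right)
  have "square_summable (\<lambda>i. F (coord x i))"
    unfolding square_summable_def
    by (rule summable_on_comparison_test[OF summ]) (simp_all add: le)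
  then show ?thesis unfolding nemytskii_def by (subst Ell2_inverse) simp_all
qed

definition relatively_dense :: "real set \<Rightarrow> bool" where
  "relatively_dense A \<longleftrightarrow> (\<exists>l>0. \<forall>a. A \<inter> {a..a + l} \<noteq> {})"

definition almost_periodic :: "(real \<Rightarrow> 'a::real_normed_vector) \<Rightarrow> bool" where
  "almost_periodic f \<longleftrightarrow> continuous_on UNIV f \<and>
     (\<forall>\<epsilon>>0. relatively_dense {\<tau>. \<forall>t. norm (f (t + \<tau>) - f t) < \<epsilon>})"

text \<open>The topological space \<open>C('a, 'b)\<close>; its carrier (the case \<open>K = {}\<close> below) consists of
  the continuous functions only.\<close>

definition compact_open_topology ::
    "('a::topological_space \<Rightarrow> 'b::topological_space) topology" where
  "compact_open_topology =
     topology_generated_by {{f. continuous_on UNIV f \<and> f ` K \<subseteq> U} | K U. compact K \<and> open U}"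

definition shift :: "real \<Rightarrow> (real \<Rightarrow> 'a) \<Rightarrow> real \<Rightarrow> 'a" where
  "shift h g = (\<lambda>t. g (t + h))"

definition translation_hull :: "(real \<Rightarrow> 'a::topological_space) \<Rightarrow> (real \<Rightarrow> 'a) set" where
  "translation_hull f = compact_open_topology closure_of (range (\<lambda>h. shift h f))"

definition solves_lattice_equation ::
    "real \<Rightarrow> real \<Rightarrow> (real \<Rightarrow> real) \<Rightarrow> (real \<Rightarrow> ell2) \<Rightarrow> (real \<Rightarrow> ell2) \<Rightarrow> bool" where
  "solves_lattice_equation \<nu> lam F g u \<longleftrightarrow>
     (\<forall>t\<ge>0. (u has_vector_derivative
        \<nu> *\<^sub>R laplacian (u t) - lam *\<^sub>R u t + nemytskii F (u t) + g t) (at t within {0..}))"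

text \<open>\<open>\<phi> t v g\<close> is only constrained for \<open>t \<ge> 0\<close> and \<open>g \<in> translation_hull f\<close>. There, uniqueness of
  solutions makes it the cocycle generated by the equation; its continuity and the
  cocycle identity are consequences and are not part of the definition.\<close>

definition generated_cocycle ::
    "real \<Rightarrow> real \<Rightarrow> (real \<Rightarrow> real) \<Rightarrow> (real \<Rightarrow> ell2)
      \<Rightarrow> (real \<Rightarrow> ell2 \<Rightarrow> (real \<Rightarrow> ell2) \<Rightarrow> ell2) \<Rightarrow> bool" where
  "generated_cocycle \<nu> lam F f \<phi> \<longleftrightarrow>
     (\<forall>v. \<forall>g\<in>translation_hull f. \<phi> 0 v g = v \<and> solves_lattice_equation \<nu> lam F g (\<lambda>t. \<phi> t v g))"

text \<open>A map on the hull is represented by a total function, whose values outside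
  the hull are irrelevant.\<close>

definition invariant_section ::
    "(real \<Rightarrow> 'a::topological_space) \<Rightarrow> (real \<Rightarrow> 'a \<Rightarrow> (real \<Rightarrow> 'a) \<Rightarrow> 'a)
      \<Rightarrow> ((real \<Rightarrow> 'a) \<Rightarrow> 'a) \<Rightarrow> bool" where
  "invariant_section f \<phi> \<gamma> \<longleftrightarrow>
     continuous_map (subtopology compact_open_topology (translation_hull f)) euclidean \<gamma> \<and>
     (\<forall>t\<ge>0. \<forall>g\<in>translation_hull f. \<phi> t (\<gamma> g) g = \<gamma> (shift t g))"

end

theory Submission imports Defs begin

text \<open>
  The difference \<open>w\<close> of two solutions satisfies the energy inequality
  \<open>d/dt \<parallel>w\<parallel>\<^sup>2 \<le> - 2 (\<lambda> + \<alpha>) \<parallel>w\<parallel>\<^sup>2 + 2 \<parallel>w\<parallel> \<parallel>g\<^sub>1 - g\<^sub>2\<parallel>\<close>, because the Laplacian is dissipative.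
  Hence the cocycle contracts at rate \<open>\<lambda> + \<alpha>\<close>, and the pullback limit
  \<open>\<gamma> g = lim \<phi> s 0 (g shifted by - s)\<close>, \<open>s \<rightarrow> \<infinity>\<close>, exists. Any other section \<open>\<gamma>'\<close> agrees with it: by almost
  periodicity \<open>g\<close> shifted by \<open>- \<tau>\<close> returns uniformly close to \<open>g\<close> for arbitrarily large \<open>\<tau>\<close>, so
  continuity of \<open>\<gamma>'\<close> bounds \<open>\<gamma>' - \<gamma>\<close> along these shifts, and contraction over time \<open>\<tau>\<close>
  forces \<open>\<gamma>' g = \<gamma> g\<close>. In this way compactness of the hull is never needed.
\<close>

section \<open>The compact-open topology and hulls\<close>

lemma topspace_compact_open_topology:
  "topspace compact_open_topology = {f. continuous_on UNIV f}"
proof -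
  have "{f::'a\<Rightarrow>'b. continuous_on UNIV f}
      \<in> {{f. continuous_on UNIV f \<and> f ` K \<subseteq> U} |K U. compact K \<and> open U}"
    by (rule CollectI, rule exI[of _ "{}"], rule exI[of _ UNIV]) auto
  then show ?thesis
    unfolding compact_open_topology_def topology_generated_by_topspace by blast
qed

lemma openin_compact_open_subbasis:
  assumes "compact K" "open U"
  shows "openin compact_open_topology {f. continuous_on UNIV f \<and> f ` K \<subseteq> U}"
  unfolding compact_open_topology_def
  by (rule topology_generated_by_Basis) (use assms in blast)

text \<open>Singletons are compact, so preimages under evaluation are subbasic. Conditions at single
  times thereby become closed conditions on the hull.\<close>

lemma continuous_map_eval_compact_open:
  "continuous_map compact_open_topology euclidean (\<lambda>f. f t)"
  unfolding continuous_map topspace_compact_open_topology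
proof (intro conjI allI impI)
  fix U :: "'b set" assume "openin euclidean U"
  then have "openin compact_open_topology {f::'a \<Rightarrow> 'b. continuous_on UNIV f \<and> f ` {t} \<subseteq> U}"
    by (intro openin_compact_open_subbasis) auto
  then show "openin compact_open_topology {f \<in> {f::'a \<Rightarrow> 'b. continuous_on UNIV f}. f t \<in> U}"
    by (simp add: Collect_conj_eq)
qed auto

lemma shift_shift: "shift a (shift b g) = shift (a + b) g"
  by (simp add: shift_def add_ac)

lemma shift_0 [simp]: "shift 0 g = g"
  by (simp add: shift_def)

lemma continuous_on_shift:
  assumes "continuous_on UNIV g"
  shows "continuous_on UNIV (shift h g)"
  unfolding shift_def
  by (rule continuous_on_compose2[OF assms]) (auto intro!: continuous_intros)

lemma continuous_map_shift_compact_open: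
  "continuous_map compact_open_topology compact_open_topology
     (shift h :: (real \<Rightarrow> 'a::topological_space) \<Rightarrow> _)"
  \<comment> \<open>The definition is opened so that continuity is tested on the subbasis only, then
    folded back.\<close>
  unfolding compact_open_topology_def[where ?'a = real and ?'b = 'a]
    continuous_on_generated_topo_iff
  unfolding compact_open_topology_def[where ?'a = real and ?'b = 'a, symmetric]
proof (intro conjI allI impI)
  fix W assume "W \<in> {{f::real\<Rightarrow>'a. continuous_on UNIV f \<and> f ` K \<subseteq> U} |K U. compact K \<and> open U}"
  then obtain K and U :: "'a set" where KU: "compact K" "open U"
    and W: "W = {f. continuous_on UNIV f \<and> f ` K \<subseteq> U}" by blast
  have "shift h -` W \<inter> topspace compact_open_topology
      = {f. continuous_on UNIV f \<and> f ` ((\<lambda>t. t + h) ` K) \<subseteq> U}"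
    unfolding W topspace_compact_open_topology
    using continuous_on_shift by (auto simp: shift_def)
  moreover have "compact ((\<lambda>t. t + h) ` K)"
    by (rule compact_continuous_image[OF _ KU(1)]) (auto intro!: continuous_intros)
  ultimately show "openin compact_open_topology (shift h -` W \<inter> topspace compact_open_topology)"
    using openin_compact_open_subbasis KU(2) by metis
next
  have "shift h ` topspace compact_open_topology
      \<subseteq> topspace (compact_open_topology :: (real \<Rightarrow> 'a) topology)"
    using continuous_on_shift by (auto simp: topspace_compact_open_topology)
  then show "shift h ` topspace compact_open_topology
      \<subseteq> \<Union> {{f::real\<Rightarrow>'a. continuous_on UNIV f \<and> f ` K \<subseteq> U} |K U. compact K \<and> open U}"
    by (simp add: compact_open_topology_def topology_generated_by_topspace)
qed

text \<open>Finitely many pieces on which \<open>g\<close> varies by less than \<open>e / 2\<close>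
  cover \<open>K\<close>, and one subbasic condition per piece forces uniform closeness on all of
  \<open>K\<close>.\<close>

lemma compact_open_nhd_uniform:
  fixes g :: "'a::metric_space \<Rightarrow> 'b::metric_space"
  assumes g: "continuous_on UNIV g" and K: "compact K" and e: "e > 0"
  obtains V where "openin compact_open_topology V" "g \<in> V"
    "\<And>h t. h \<in> V \<Longrightarrow> t \<in> K \<Longrightarrow> dist (h t) (g t) < e"
proof -
  have "uniformly_continuous_on K g"
    by (intro compact_uniformly_continuous K continuous_on_subset[OF g]) auto
  then obtain d where d: "d > 0"
    "\<And>x y. x \<in> K \<Longrightarrow> y \<in> K \<Longrightarrow> dist y x < d \<Longrightarrow> dist (g y) (g x) < e / 2"
    using e unfolding uniformly_continuous_on_def by (meson half_gt_zero)
  obtain I where I: "finite I" "I \<subseteq> K" "K \<subseteq> (\<Union>x\<in>I. ball x (d / 2))"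
    using seq_compact_imp_totally_bounded[OF compact_imp_seq_compact[OF K]] d(1) by (meson half_gt_zero)
  define B where
    \<comment> \<open>Closed balls keep the pieces compact; the radius \<open>d / 2\<close> stays
      strictly inside the modulus \<open>d\<close>.\<close>
    "B x = {h. continuous_on UNIV h \<and> h ` (K \<inter> cball x (d / 2)) \<subseteq> ball (g x) (e / 2)}" for x
  \<comment> \<open>The intersection with the carrier matters when \<open>I\<close> is
    empty.\<close>
  define V where "V = (\<Inter>x\<in>I. B x) \<inter> topspace compact_open_topology"
  show thesis
  proof (rule that[of V])
    show "openin compact_open_topology V"
      unfolding V_def B_def using I(1) K
      by (intro openin_INT openin_compact_open_subbasis) auto
    show "g \<in> V"
      unfolding V_def B_def topspace_compact_open_topology
    proof (clarsimp simp: g)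
      fix x y assume "x \<in> I" "y \<in> K" "dist x y * 2 \<le> d"
      then have "dist (g y) (g x) < e / 2"
        using d(1) I(2) by (intro d(2)) (auto simp: dist_commute)
      then show "dist (g x) (g y) * 2 < e" by (simp add: dist_commute)
    qed
    fix h t assume h: "h \<in> V" and t: "t \<in> K"
    then obtain x where x: "x \<in> I" "dist x t < d / 2" using I(3) by auto
    have "dist (g t) (g x) < e / 2"
      using x d(1) I(2) t by (intro d(2)) (auto simp: dist_commute)
    moreover have "h t \<in> ball (g x) (e / 2)"
      using h x t unfolding V_def B_def by (auto simp: image_subset_iff)
    ultimately show "dist (h t) (g t) < e"
      using dist_triangle_half_l[of "h t" "g x" e "g t"] by (simp add: dist_commute)
  qed
qed

lemma compact_open_contains_uniform_ball:
  fixes g :: "'a::topological_space \<Rightarrow> 'b::metric_space"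
  assumes "openin compact_open_topology W" "g \<in> W"
  shows "\<exists>e>0. \<forall>h. continuous_on UNIV h \<longrightarrow> (\<forall>t. dist (h t) (g t) < e) \<longrightarrow> h \<in> W"
proof -
  have "generate_topology_on {{f. continuous_on UNIV f \<and> f ` K \<subseteq> U} |K U. compact K \<and> open U} W"
    using assms(1) unfolding compact_open_topology_def by (simp add: openin_topology_generated_by_iff)
  then show ?thesis
    using assms(2)
  proof (induction rule: generate_topology_on.induct)
    case (Int A B)
    then obtain e1 e2 where "e1 > 0" "e2 > 0"
      "\<forall>h. continuous_on UNIV h \<longrightarrow> (\<forall>t. dist (h t) (g t) < e1) \<longrightarrow> h \<in> A"
      "\<forall>h. continuous_on UNIV h \<longrightarrow> (\<forall>t. dist (h t) (g t) < e2) \<longrightarrow> h \<in> B"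
      by auto
    then show ?case by (intro exI[of _ "min e1 e2"]) auto
  next
    case (UN \<U>)
    then show ?case by (meson UnionE UnionI)
  next
    case (Basis W)
    then obtain K U where KU: "compact K" "open U"
      and W: "W = {f. continuous_on UNIV f \<and> f ` K \<subseteq> U}" by blast
    have "compact (g ` K)"
      using Basis(2) W KU(1) by (auto intro: compact_continuous_image continuous_on_subset)
    then obtain e where e: "e > 0" "(\<Union>x\<in>g ` K. ball x e) \<subseteq> U"
      using compact_subset_open_imp_ball_epsilon_subset[of "g ` K" U] Basis(2) W KU(2) by auto
    have "h \<in> W" if "continuous_on UNIV h" "\<forall>t. dist (h t) (g t) < e" for h
      using that e(2) unfolding W by (fastforce simp: dist_commute)
    then show ?case using e(1) by blast
  qed auto
qed

section \<open>Translation hulls of almost periodic functions\<close>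

lemma translation_hull_continuous: "g \<in> translation_hull f \<Longrightarrow> continuous_on UNIV g"
  unfolding translation_hull_def
  using closure_of_subset_topspace[of compact_open_topology]
  by (auto simp: topspace_compact_open_topology)

text \<open>Shifts map the orbit of \<open>f\<close> into itself, and continuity extends this to the
  closure.\<close>

lemma translation_hull_shift:
  assumes "g \<in> translation_hull f"
  shows "shift h g \<in> translation_hull f"
proof -
  let ?R = "range (\<lambda>k. shift k f)"
  have sub: "shift h ` ?R \<subseteq> ?R"
  proof (rule image_subsetI)
    fix x assume "x \<in> ?R"
    then obtain k where "x = shift k f" by (rule imageE)
    then show "shift h x \<in> ?R" by (metis shift_shift rangeI)
  qed
  have "shift h g \<in> shift h ` (compact_open_topology closure_of ?R)"
    using assms unfolding translation_hull_def by (rule imageI)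
  then have "shift h g \<in> compact_open_topology closure_of (shift h ` ?R)"
    by (rule subsetD[OF continuous_map_image_closure_subset[OF continuous_map_shift_compact_open]])
  then show ?thesis
    unfolding translation_hull_def by (rule subsetD[OF closure_of_mono[OF sub]])
qed

text \<open>The preimage of \<open>S\<close> is closed and contains the orbit, hence its closure.
  This transfers non-strict estimates from \<open>f\<close> to its whole hull.\<close>

lemma translation_hull_closed_condition:
  assumes g: "g \<in> translation_hull f" and \<Psi>: "continuous_map compact_open_topology euclidean \<Psi>"
    and S: "closed S" "\<And>k. \<Psi> (shift k f) \<in> S"
  shows "\<Psi> g \<in> S"
proof -
  let ?C = "{h \<in> topspace compact_open_topology. \<Psi> h \<in> S}"
  have "closedin compact_open_topology ?C"
    by (rule closedin_continuous_map_preimage[OF \<Psi>]) (use S in simp)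
  moreover have "topspace compact_open_topology \<inter> range (\<lambda>h. shift h f) \<subseteq> ?C"
    using S(2) by auto
  ultimately have "translation_hull f \<subseteq> ?C"
    unfolding translation_hull_def by (metis closure_of_minimal closure_of_restrict)
  then show ?thesis using g by auto
qed

text \<open>A suitable almost period moves any time into the compact interval \<open>{0..l}\<close>,
  where \<open>f\<close> is bounded, at the cost of an error below 1.\<close>

lemma almost_periodic_bounded:
  assumes "almost_periodic f"
  obtains M where "M \<ge> 0" "\<And>t. norm (f t) \<le> M"
proof -
  obtain l where l: "\<And>a. {\<tau>. \<forall>t. norm (f (t + \<tau>) - f t) < 1} \<inter> {a..a + l} \<noteq> {}"
    using assms unfolding almost_periodic_def relatively_dense_def by (meson zero_less_one)
  have "compact (f ` {0..l})"
    using assms unfolding almost_periodic_def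
    by (auto intro: compact_continuous_image continuous_on_subset)
  then obtain B where B: "\<And>t. t \<in> {0..l} \<Longrightarrow> norm (f t) \<le> B"
    using compact_imp_bounded bounded_iff by (metis imageI)
  have le: "norm (f t) \<le> B + 1" for t
  proof -
    obtain \<tau> where "norm (f (t + \<tau>) - f t) < 1" "- t \<le> \<tau>" "\<tau> \<le> - t + l"
      using l[of "- t"] by (auto simp del: uminus_add_conv_diff) blast
    then show ?thesis using B[of "t + \<tau>"] norm_triangle_sub[of "f t" "f (t + \<tau>)"]
      by (auto simp: norm_minus_commute)
  qed
  moreover have "B + 1 \<ge> 0" using le[of 0] norm_ge_zero[of "f 0"] by linarith
  ultimately show thesis using that by blast
qed

text \<open>Almost periods of \<open>f\<close> serve every hull element, because the estimate at
  each fixed time is a closed condition. The closure only preserves \<open>\<le>\<close>, so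
  \<open>e / 2\<close> is used to end strictly below \<open>e\<close>.\<close>

lemma almost_periodic_hull_return:
  assumes f: "almost_periodic f" and g: "g \<in> translation_hull f" and e: "e > 0"
  obtains \<tau> where "\<tau> \<ge> N" "\<And>t. norm (shift (- \<tau>) g t - g t) < e"
proof -
  have "relatively_dense {\<tau>. \<forall>t. norm (f (t + \<tau>) - f t) < e / 2}"
    using f e unfolding almost_periodic_def by (meson half_gt_zero)
  then obtain l where "\<And>a. {\<tau>. \<forall>t. norm (f (t + \<tau>) - f t) < e / 2} \<inter> {a..a + l} \<noteq> {}"
    unfolding relatively_dense_def by blast
  from this[of N] obtain \<tau> where \<tau>: "\<tau> \<ge> N" "\<And>t. norm (f (t + \<tau>) - f t) < e / 2"
    by (metis (mono_tags, lifting) IntE atLeastAtMost_iff ex_in_conv mem_Collect_eq)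
  have "norm (shift (- \<tau>) g t - g t) < e" for t
  proof -
    have "norm (shift k f (t - \<tau>) - shift k f t) \<le> e / 2" for k
      using \<tau>(2)[of "t - \<tau> + k"] by (simp add: shift_def norm_minus_commute algebra_simps)
    then have "norm (g (t - \<tau>) - g t) \<in> {..e / 2}"
      by (intro translation_hull_closed_condition[OF g, where \<Psi> = "\<lambda>h. norm (h (t - \<tau>) - h t)"]
          continuous_map_norm continuous_map_diff continuous_map_eval_compact_open) auto
    then show ?thesis using e by (simp add: shift_def)
  qed
  then show thesis using \<tau>(1) that by blast
qed

section \<open>Energy estimates\<close>

text \<open>Each mixed product is at most half the sum of the two squares, and the sum of squares is
  invariant under index shifts, so the resulting upper bound sums to zero.\<close>

lemma inner_laplacian_nonpos: "inner w (laplacian w) \<le> 0"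
proof -
  let ?s = "\<lambda>k i. (coord w (i + k))\<^sup>2"
  have bij: "bij_betw (\<lambda>i::int. i + k) UNIV UNIV" for k
    by (rule bij_betwI[of _ _ _ "\<lambda>i. i - k"]) auto
  have summ: "?s k summable_on UNIV" for k
    using square_summable_shift[OF square_summable_coord] unfolding square_summable_def by auto
  have eq: "infsum (?s k) UNIV = infsum (?s 0) UNIV" for k
    using infsum_reindex_bij_betw[OF bij, of "?s 0"] by simp
  have "inner w (laplacian w)
      \<le> (\<Sum>\<^sub>\<infinity>i\<in>UNIV. (1/2) * ?s (-1) i + (1/2) * ?s 1 i + (-1) * ?s 0 i)"
    unfolding inner_ell2_def
  proof (rule infsum_mono)
    show "(\<lambda>i. coord w i * coord (laplacian w) i) summable_on UNIV"
      by (intro square_summable_mult square_summable_coord)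
    show "(\<lambda>i. (1/2) * ?s (-1) i + (1/2) * ?s 1 i + (-1) * ?s 0 i) summable_on UNIV"
      by (intro summable_on_add summable_on_cmult_right summ)
    fix i
    show "coord w i * coord (laplacian w) i \<le> (1/2) * ?s (-1) i + (1/2) * ?s 1 i + (-1) * ?s 0 i"
      using zero_le_power2[of "coord w i - coord w (i - 1)"]
        zero_le_power2[of "coord w i - coord w (i + 1)"]
      by (simp add: laplacian.rep_eq power2_eq_square algebra_simps)
  qed
  also have "\<dots> = (1/2) * infsum (?s (-1)) UNIV + (1/2) * infsum (?s 1) UNIV + (-1) * infsum (?s 0) UNIV"
    by (simp only: infsum_add infsum_cmult_right summable_on_add summable_on_cmult_right summ)
  also have "\<dots> = 0" unfolding eq[of 1] eq[of "-1"] by simp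
  finally show ?thesis .
qed

lemma laplacian_diff: "laplacian (x - y) = laplacian x - laplacian y"
  by (rule ell2_eqI) (simp add: laplacian.rep_eq minus_ell2.rep_eq)

lemma inner_nemytskii_diff_le:
  assumes F: "lipschitz_on_bounded_sets F" "F 0 = 0"
    and mono: "\<And>x1 x2. (x1 - x2) * (F x1 - F x2) \<le> - \<alpha> * \<bar>x1 - x2\<bar>\<^sup>2"
  shows "inner (x - y) (nemytskii F x - nemytskii F y) \<le> - \<alpha> * (norm (x - y))\<^sup>2"
proof -
  have "inner (x - y) (nemytskii F x - nemytskii F y)
      \<le> (\<Sum>\<^sub>\<infinity>i\<in>UNIV. - \<alpha> * (coord (x - y) i)\<^sup>2)"
    unfolding inner_ell2_def
  proof (rule infsum_mono)
    show "(\<lambda>i. coord (x - y) i * coord (nemytskii F x - nemytskii F y) i) summable_on UNIV"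
      by (intro square_summable_mult square_summable_coord)
    show "(\<lambda>i. - \<alpha> * (coord (x - y) i)\<^sup>2) summable_on UNIV"
      using square_summable_coord by (intro summable_on_cmult_right) (simp add: square_summable_def)
    show "coord (x - y) i * coord (nemytskii F x - nemytskii F y) i \<le> - \<alpha> * (coord (x - y) i)\<^sup>2" for i
      using mono[of "coord x i" "coord y i"] by (simp add: minus_ell2.rep_eq coord_nemytskii[OF F])
  qed
  also have "\<dots> = - \<alpha> * (norm (x - y))\<^sup>2"
    unfolding norm_ell2_sq
    using square_summable_coord by (intro infsum_cmult_right) (simp add: square_summable_def)
  finally show ?thesis .
qed

text \<open>Gronwall's argument with an integrating factor:
  \<open>z t = exp (a * t) * (y t - b / a)\<close> does not increase.\<close>

lemma linear_differential_inequality: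
  fixes y :: "real \<Rightarrow> real"
  assumes a: "a > 0" and b: "b \<ge> 0" and T: "T \<ge> 0"
    and der: "\<And>t. t \<ge> 0 \<Longrightarrow> (y has_vector_derivative y' t) (at t within {0..})"
    and le: "\<And>t. 0 \<le> t \<Longrightarrow> t \<le> T \<Longrightarrow> y' t \<le> - a * y t + b"
  shows "y T \<le> exp (- a * T) * y 0 + b / a"
proof -
  define z where "z t = exp (a * t) * (y t - b / a)" for t
  have cont: "continuous_on {0..T} y"
    unfolding continuous_on_eq_continuous_within
    by (auto intro!: has_vector_derivative_continuous has_vector_derivative_within_subset[OF der])
  have "z T \<le> z 0"
  \<comment> \<open>At time 0 only a one-sided derivative is available, so derivatives are taken in
    the open interval and the endpoints are handled by continuity.\<close>
  proof (rule DERIV_nonpos_imp_decreasing_open[OF T])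
    fix t assume t: "0 < t" "t < T"
    have "at t within {0..} = at t"
      by (rule at_within_interior) (use t in \<open>simp add: interior_real_atLeast\<close>)
    then have "(y has_real_derivative y' t) (at t)"
      using der[of t] t by (simp add: has_real_derivative_iff_has_vector_derivative)
    then have "(z has_real_derivative exp (a * t) * (y' t + a * y t - b)) (at t)"
      unfolding z_def using a by (auto intro!: derivative_eq_intros simp: algebra_simps)
    moreover have "exp (a * t) * (y' t + a * y t - b) \<le> 0"
      using le[of t] t by (intro mult_nonneg_nonpos) auto
    ultimately show "\<exists>d. (z has_real_derivative d) (at t) \<and> d \<le> 0" by blast
  next
    show "continuous_on {0..T} z"
      unfolding z_def by (intro continuous_intros cont)
  qed
  then have "exp (- a * T) * (exp (a * T) * (y T - b / a)) \<le> exp (- a * T) * (y 0 - b / a)"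
    unfolding z_def by (intro mult_left_mono) auto
  then have "y T - b / a \<le> exp (- a * T) * (y 0 - b / a)"
    by (simp add: mult.assoc[symmetric] exp_add[symmetric])
  moreover have "exp (- a * T) * (b / a) \<ge> 0" using a b by simp
  ultimately show ?thesis by (simp add: algebra_simps)
qed

section \<open>Comparison of solutions of the lattice equation\<close>

locale dissipative_lattice_equation =
  fixes \<nu> lam \<alpha> :: real and F :: "real \<Rightarrow> real"
  assumes nu: "\<nu> > 0" and lam: "lam > 0" and alpha: "\<alpha> \<ge> 0"
    and F: "lipschitz_on_bounded_sets F" "F 0 = 0"
    and monotone: "\<And>x1 x2. (x1 - x2) * (F x1 - F x2) \<le> - \<alpha> * \<bar>x1 - x2\<bar>\<^sup>2"
begin

text \<open>The autonomous part of the right-hand side, kept apart from the forcing so that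
  solutions with different forcings can be compared.\<close>

definition vf where "vf u = \<nu> *\<^sub>R laplacian u - lam *\<^sub>R u + nemytskii F u"

lemma inner_vf_diff_le: "inner (x - y) (vf x - vf y) \<le> - (lam + \<alpha>) * (norm (x - y))\<^sup>2"
proof -
  have "vf x - vf y
      = \<nu> *\<^sub>R laplacian (x - y) - lam *\<^sub>R (x - y) + (nemytskii F x - nemytskii F y)"
    by (simp add: vf_def laplacian_diff algebra_simps)
  then have "inner (x - y) (vf x - vf y) = \<nu> * inner (x - y) (laplacian (x - y))
      - lam * (norm (x - y))\<^sup>2 + inner (x - y) (nemytskii F x - nemytskii F y)"
    by (simp only: inner_add_right inner_diff_right[of _ "\<nu> *\<^sub>R _"] inner_scaleR_right
        power2_norm_eq_inner)
  also have "\<dots> \<le> 0 - lam * (norm (x - y))\<^sup>2 + - \<alpha> * (norm (x - y))\<^sup>2"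
    using nu by (intro add_mono diff_mono mult_nonneg_nonpos inner_laplacian_nonpos
        inner_nemytskii_diff_le F monotone) auto
  finally show ?thesis by (simp add: algebra_simps)
qed

lemma solves_iff:
  "solves_lattice_equation \<nu> lam F g u
     \<longleftrightarrow> (\<forall>t\<ge>0. (u has_vector_derivative vf (u t) + g t) (at t within {0..}))"
  by (simp add: solves_lattice_equation_def vf_def)

text \<open>Comparison with this trivial unforced solution turns estimates of differences into
  bounds on single solutions.\<close>

lemma solves_zero: "solves_lattice_equation \<nu> lam F (\<lambda>t. 0) (\<lambda>t. 0)"
proof -
  have "vf 0 = 0"
    by (rule ell2_eqI)
      (simp add: vf_def scaleR_ell2.rep_eq laplacian.rep_eq zero_ell2.rep_eq plus_ell2.rep_eq coord_nemytskii F)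
  then show ?thesis by (simp add: solves_iff)
qed

lemma solves_shift:
  assumes "solves_lattice_equation \<nu> lam F g u" "s \<ge> 0"
  shows "solves_lattice_equation \<nu> lam F (shift s g) (\<lambda>t. u (t + s))"
  unfolding solves_iff
proof (intro allI impI)
  fix t :: real assume t: "t \<ge> 0"
  have "(u has_vector_derivative vf (u (t + s)) + g (t + s)) (at (t + s) within {0..})"
    using assms t unfolding solves_iff by simp
  \<comment> \<open>The translated half-line lies in \<open>{0..}\<close> because
    \<open>s \<ge> 0\<close>; the chain rule needs the derivative within it.\<close>
  then have "(u has_vector_derivative vf (u (t + s)) + g (t + s)) (at (t + s) within (\<lambda>t. t + s) ` {0..})"
    by (rule has_vector_derivative_within_subset) (use assms(2) in auto)
  moreover have "((\<lambda>t. t + s) has_vector_derivative 1) (at t within {0..})"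
    by (auto intro!: derivative_eq_intros)
  ultimately show "((\<lambda>t. u (t + s)) has_vector_derivative vf (u (t + s)) + shift s g t) (at t within {0..})"
    using vector_diff_chain_within[of "\<lambda>t. t + s" 1 t "{0..}" u] by (simp add: shift_def o_def)
qed

lemma norm_sq_diff_has_derivative:
  assumes "solves_lattice_equation \<nu> lam F g1 u1" "solves_lattice_equation \<nu> lam F g2 u2" "t \<ge> 0"
  shows "((\<lambda>t. (norm (u1 t - u2 t))\<^sup>2) has_vector_derivative
      2 * (inner (u1 t - u2 t) (vf (u1 t) - vf (u2 t)) + inner (u1 t - u2 t) (g1 t - g2 t)))
      (at t within {0..})"
proof -
  let ?w = "\<lambda>t. u1 t - u2 t" and ?d = "(vf (u1 t) + g1 t) - (vf (u2 t) + g2 t)"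
  have w: "(?w has_vector_derivative ?d) (at t within {0..})"
    using assms by (intro has_vector_derivative_diff) (auto simp: solves_iff)
  have "((\<lambda>t. inner (?w t) (?w t)) has_vector_derivative inner (?w t) ?d + inner ?d (?w t))
      (at t within {0..})"
    by (rule bounded_bilinear.has_vector_derivative[OF bounded_bilinear_inner w w])
  moreover have "inner (?w t) ?d + inner ?d (?w t)
      = 2 * (inner (?w t) (vf (u1 t) - vf (u2 t)) + inner (?w t) (g1 t - g2 t))"
    unfolding inner_commute[of ?d] by (simp add: inner_diff_right inner_add_right)
  ultimately show ?thesis by (simp add: power2_norm_eq_inner)
qed

text \<open>With equal forcings the differential inequality has \<open>b = 0\<close>; the squared
  norm decays at twice the rate. Equal initial values give uniqueness of solutions.\<close>

lemma contraction:
  assumes "solves_lattice_equation \<nu> lam F g u1" "solves_lattice_equation \<nu> lam F g u2" "t \<ge> 0"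
  shows "norm (u1 t - u2 t) \<le> exp (- (lam + \<alpha>) * t) * norm (u1 0 - u2 0)"
proof -
  have "(norm (u1 t - u2 t))\<^sup>2
      \<le> exp (- (2 * (lam + \<alpha>)) * t) * (norm (u1 0 - u2 0))\<^sup>2 + 0 / (2 * (lam + \<alpha>))"
  proof (rule linear_differential_inequality[OF _ _ assms(3) norm_sq_diff_has_derivative[OF assms(1,2)]])
    show "2 * (inner (u1 s - u2 s) (vf (u1 s) - vf (u2 s)) + inner (u1 s - u2 s) (g s - g s))
        \<le> - (2 * (lam + \<alpha>)) * (norm (u1 s - u2 s))\<^sup>2 + 0" for s
      using inner_vf_diff_le[of "u1 s" "u2 s"] by (simp add: left_diff_distrib)
  qed (use lam alpha in auto)
  also have "\<dots> = (exp (- (lam + \<alpha>) * t) * norm (u1 0 - u2 0))\<^sup>2"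
    by (simp add: power_mult_distrib exp_double[symmetric] algebra_simps)
  finally show ?thesis by (rule power2_le_imp_le) simp
qed

text \<open>The forcing term is absorbed by giving up half of the dissipation, so the squared norm
  decays at rate \<open>lam + \<alpha>\<close> only, instead of twice that.\<close>

lemma forcing_dependence:
  assumes "solves_lattice_equation \<nu> lam F g1 u1" "solves_lattice_equation \<nu> lam F g2 u2" "t \<ge> 0"
    and d: "\<And>s. 0 \<le> s \<Longrightarrow> s \<le> t \<Longrightarrow> norm (g1 s - g2 s) \<le> d"
  shows "(norm (u1 t - u2 t))\<^sup>2
      \<le> exp (- (lam + \<alpha>) * t) * (norm (u1 0 - u2 0))\<^sup>2 + (d / (lam + \<alpha>))\<^sup>2"
proof -
  let ?k = "lam + \<alpha>"
  have k: "?k > 0" using lam alpha by simp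
  have "(norm (u1 t - u2 t))\<^sup>2 \<le> exp (- ?k * t) * (norm (u1 0 - u2 0))\<^sup>2 + (d\<^sup>2 / ?k) / ?k"
  proof (rule linear_differential_inequality[OF k _ assms(3) norm_sq_diff_has_derivative[OF assms(1,2)]])
    fix s assume s: "0 \<le> s" "s \<le> t"
    let ?w = "u1 s - u2 s"
    have "inner ?w (g1 s - g2 s) \<le> norm ?w * d"
      using norm_cauchy_schwarz[of ?w "g1 s - g2 s"] d[OF s] mult_left_mono[OF _ norm_ge_zero]
      by (meson order_trans)
    \<comment> \<open>Young's inequality with weight \<open>?k\<close>, by completing the
      square.\<close>
    moreover have "2 * (norm ?w * d) \<le> ?k * (norm ?w)\<^sup>2 + d\<^sup>2 / ?k"
    proof -
      have "0 \<le> (?k * norm ?w - d)\<^sup>2 / ?k" using k by simp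
      also have "\<dots> = ?k * (norm ?w)\<^sup>2 + d\<^sup>2 / ?k - 2 * (norm ?w * d)"
        using k by (simp add: power2_eq_square field_simps)
      finally show ?thesis by simp
    qed
    ultimately show "2 * (inner ?w (vf (u1 s) - vf (u2 s)) + inner ?w (g1 s - g2 s))
        \<le> - ?k * (norm ?w)\<^sup>2 + d\<^sup>2 / ?k"
      using inner_vf_diff_le[of "u1 s" "u2 s"] by (simp add: algebra_simps)
  qed (use k in auto)
  then show ?thesis by (simp add: power_divide power2_eq_square)
qed

end

section \<open>The invariant section\<close>

locale dissipative_lattice_cocycle = dissipative_lattice_equation +
  fixes f :: "real \<Rightarrow> ell2" and \<phi> :: "real \<Rightarrow> ell2 \<Rightarrow> (real \<Rightarrow> ell2) \<Rightarrow> ell2"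
  assumes ap: "almost_periodic f" and cocycle: "generated_cocycle \<nu> lam F f \<phi>"
begin

abbreviation H where "H \<equiv> translation_hull f"

lemma phi_0: "g \<in> H \<Longrightarrow> \<phi> 0 v g = v"
  and phi_solves: "g \<in> H \<Longrightarrow> solves_lattice_equation \<nu> lam F g (\<lambda>t. \<phi> t v g)"
  using cocycle unfolding generated_cocycle_def by auto

lemma phi_contraction:
  assumes "g \<in> H" "t \<ge> 0"
  shows "norm (\<phi> t v g - \<phi> t w g) \<le> exp (- (lam + \<alpha>) * t) * norm (v - w)"
  using contraction[OF phi_solves phi_solves, OF assms(1,1,2), of v w] assms(1) by (simp add: phi_0)

text \<open>Both sides, as functions of \<open>t\<close>, solve the equation with forcing
  \<open>shift s g\<close> and agree at \<open>t = 0\<close>; contraction leaves them no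
  distance.\<close>

lemma phi_add:
  assumes g: "g \<in> H" and "t \<ge> 0" "s \<ge> 0"
  shows "\<phi> (t + s) v g = \<phi> t (\<phi> s v g) (shift s g)"
  using contraction[OF solves_shift[OF phi_solves[OF g] assms(3)]
      phi_solves[OF translation_hull_shift[OF g]] assms(2), of v "\<phi> s v g"]
    phi_0[OF translation_hull_shift[OF g]]
  by simp

section \<open>Uniform bounds and pullback limits\<close>

definition radius where
  "radius = (SOME R. R \<ge> 0 \<and> (\<forall>g\<in>H. \<forall>t\<ge>0. norm (\<phi> t 0 g) \<le> R))"

text \<open>The bound \<open>M\<close> on \<open>f\<close> passes to every forcing in the hull, and
  comparison with the zero solution of the unforced equation gives the witness
  \<open>M / (lam + \<alpha>)\<close>.\<close>

lemma radius: "radius \<ge> 0" "g \<in> H \<Longrightarrow> t \<ge> 0 \<Longrightarrow> norm (\<phi> t 0 g) \<le> radius"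
proof -
  obtain M where M: "M \<ge> 0" "\<And>t. norm (f t) \<le> M"
    using almost_periodic_bounded[OF ap] by blast
  have "norm (\<phi> t 0 g) \<le> M / (lam + \<alpha>)" if g: "g \<in> H" and t: "t \<ge> 0" for g t
  proof (rule power2_le_imp_le)
    have "norm (g s) \<in> {..M}" for s
      by (intro translation_hull_closed_condition[OF g, where \<Psi> = "\<lambda>h. norm (h s)"]
          continuous_map_norm continuous_map_eval_compact_open) (auto simp: shift_def M(2))
    then show "(norm (\<phi> t 0 g))\<^sup>2 \<le> (M / (lam + \<alpha>))\<^sup>2"
      using forcing_dependence[OF phi_solves[OF g] solves_zero t, of M 0] phi_0[OF g] by simp
    show "0 \<le> M / (lam + \<alpha>)" using M(1) lam alpha by simp
  qed
  then have "\<exists>R. R \<ge> 0 \<and> (\<forall>g\<in>H. \<forall>t\<ge>0. norm (\<phi> t 0 g) \<le> R)"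
    using M(1) lam alpha by (intro exI[of _ "M / (lam + \<alpha>)"]) auto
  from someI_ex[OF this] show "radius \<ge> 0" "g \<in> H \<Longrightarrow> t \<ge> 0 \<Longrightarrow> norm (\<phi> t 0 g) \<le> radius"
    unfolding radius_def by auto
qed

text \<open>The state at time 0 of the solution with forcing \<open>g\<close> that starts from 0 at
  time \<open>- s\<close>.\<close>

definition pullback where "pullback s g = \<phi> s 0 (shift (- s) g)"

text \<open>The solution started at \<open>- r\<close> has norm at most \<open>radius\<close> at
  time \<open>- s\<close>, when the other one starts from 0; they then contract for a time
  \<open>s\<close>.\<close>

lemma pullback_cauchy:
  assumes g: "g \<in> H" and "0 \<le> s" "s \<le> r"
  shows "norm (pullback r g - pullback s g) \<le> exp (- (lam + \<alpha>) * s) * radius"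
proof -
  have "pullback r g = \<phi> s (\<phi> (r - s) 0 (shift (- r) g)) (shift (- s) g)"
    using phi_add[OF translation_hull_shift[OF g], of s "r - s" 0 "- r"] assms
    by (simp add: pullback_def shift_shift)
  then have "norm (pullback r g - pullback s g)
      \<le> exp (- (lam + \<alpha>) * s) * norm (\<phi> (r - s) 0 (shift (- r) g) - 0)"
    using phi_contraction[OF translation_hull_shift[OF g] assms(2)] unfolding pullback_def by metis
  also have "\<dots> \<le> exp (- (lam + \<alpha>) * s) * radius"
    using radius(2)[OF translation_hull_shift[OF g]] assms by (intro mult_left_mono) auto
  finally show ?thesis .
qed

lemma decay: "((\<lambda>s. exp (- (lam + \<alpha>) * s) * c) \<longlongrightarrow> 0) at_top"
proof (rule tendsto_mult_left_zero)
  have "filterlim (\<lambda>s. (lam + \<alpha>) * s) at_top at_top"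
    using lam alpha by (intro filterlim_tendsto_pos_mult_at_top[OF tendsto_const]) (auto simp: filterlim_ident)
  then have "filterlim (\<lambda>s. - ((lam + \<alpha>) * s)) at_bot at_top"
    by (simp only: filterlim_uminus_at_top)
  then show "((\<lambda>s. exp (- (lam + \<alpha>) * s)) \<longlongrightarrow> 0) at_top"
    unfolding mult_minus_left by (rule filterlim_compose[OF exp_at_bot])
qed

text \<open>Integer times suffice to define the limit through completeness; the next estimate covers
  all real \<open>s \<ge> 0\<close>.\<close>

definition pullback_limit where "pullback_limit g = lim (\<lambda>n. pullback (real n) g)"

lemma norm_pullback_diff_limit_le:
  assumes g: "g \<in> H" and s: "s \<ge> 0"
  shows "norm (pullback s g - pullback_limit g) \<le> exp (- (lam + \<alpha>) * s) * radius"
proof -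
  have "Cauchy (\<lambda>n. pullback (real n) g)"
  proof (rule CauchyI)
    fix e :: real assume "e > 0"
    have "(\<lambda>n. exp (- (lam + \<alpha>) * real n) * radius) \<longlonglongrightarrow> 0"
      by (rule filterlim_compose[OF decay filterlim_real_sequentially])
    from order_tendstoD(2)[OF this, of "e / 2"] obtain N :: nat
      where N: "exp (- (lam + \<alpha>) * real N) * radius < e / 2"
      using \<open>e > 0\<close> unfolding eventually_sequentially by auto
    have "dist (pullback (real n) g) (pullback (real N) g) < e / 2" if "n \<ge> N" for n
      using pullback_cauchy[OF g, of "real N" "real n"] N that by (simp add: dist_norm)
    then have "dist (pullback (real m) g) (pullback (real n) g) < e" if "m \<ge> N" "n \<ge> N" for m n
      using that by (meson dist_triangle_half_l)
    then show "\<exists>N. \<forall>m\<ge>N. \<forall>n\<ge>N. norm (pullback (real m) g - pullback (real n) g) < e"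
      by (auto simp: dist_norm)
  qed
  then have lim: "(\<lambda>n. pullback (real n) g) \<longlonglongrightarrow> pullback_limit g"
    unfolding pullback_limit_def using Cauchy_convergent convergent_LIMSEQ_iff by blast
  have "norm (pullback_limit g - pullback s g) \<le> exp (- (lam + \<alpha>) * s) * radius"
  \<comment> \<open>The later time in \<open>pullback_cauchy\<close> tends to infinity while
    \<open>s\<close> stays fixed.\<close>
  proof (rule tendsto_upperbound)
    show "(\<lambda>n. norm (pullback (real n) g - pullback s g)) \<longlonglongrightarrow> norm (pullback_limit g - pullback s g)"
      by (intro tendsto_intros lim)
    show "\<forall>\<^sub>F n in sequentially. norm (pullback (real n) g - pullback s g)
        \<le> exp (- (lam + \<alpha>) * s) * radius"
      using eventually_ge_at_top[of "nat \<lceil>s\<rceil>"]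
    proof eventually_elim
      case (elim n)
      then show ?case by (intro pullback_cauchy[OF g s]) linarith
    qed
  qed simp
  then show ?thesis by (simp add: norm_minus_commute)
qed

lemma pullback_tendsto:
  assumes "g \<in> H"
  shows "((\<lambda>s. pullback s g) \<longlongrightarrow> pullback_limit g) at_top"
  unfolding tendsto_dist_iff[of _ "pullback_limit g"] dist_norm
proof (rule tendsto_sandwich[OF _ _ tendsto_const decay])
  show "\<forall>\<^sub>F s in at_top. norm (pullback s g - pullback_limit g) \<le> exp (- (lam + \<alpha>) * s) * radius"
    by (rule eventually_mono[OF eventually_ge_at_top norm_pullback_diff_limit_le[OF assms]])
qed simp

text \<open>The case \<open>s = 0\<close> of the preceding estimate, where the pullback is still
  0.\<close>

lemma norm_pullback_limit_le: "g \<in> H \<Longrightarrow> norm (pullback_limit g) \<le> radius"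
  using norm_pullback_diff_limit_le[of g 0] phi_0[of g 0] by (simp add: pullback_def)

text \<open>The cocycle sends \<open>pullback s g\<close> to
  \<open>pullback (t + s) (shift t g)\<close>. As \<open>s\<close> grows, the images converge to
  both sides, since \<phi> is Lipschitz in the initial value.\<close>

lemma pullback_limit_invariant:
  assumes g: "g \<in> H" and t: "t \<ge> 0"
  shows "\<phi> t (pullback_limit g) g = pullback_limit (shift t g)"
proof -
  have "((\<lambda>s. pullback (t + s) (shift t g)) \<longlongrightarrow> pullback_limit (shift t g)) at_top"
    by (rule filterlim_compose[OF pullback_tendsto[OF translation_hull_shift[OF g]]])
      (intro filterlim_tendsto_add_at_top[OF tendsto_const] filterlim_ident)
  moreover have "((\<lambda>s. pullback (t + s) (shift t g)) \<longlongrightarrow> \<phi> t (pullback_limit g) g) at_top"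
    unfolding tendsto_dist_iff[of _ "\<phi> t (pullback_limit g) g"] dist_norm
  proof (rule tendsto_sandwich[OF _ _ tendsto_const])
    have "norm (pullback (t + s) (shift t g) - \<phi> t (pullback_limit g) g)
        \<le> exp (- (lam + \<alpha>) * t) * norm (pullback s g - pullback_limit g)" if "s \<ge> 0" for s
      using phi_add[OF translation_hull_shift[OF g] t that, of 0 "- s"]
        phi_contraction[OF g t, of "pullback s g" "pullback_limit g"]
      by (simp add: pullback_def shift_shift)
    then show "\<forall>\<^sub>F s in at_top. norm (pullback (t + s) (shift t g) - \<phi> t (pullback_limit g) g)
        \<le> exp (- (lam + \<alpha>) * t) * norm (pullback s g - pullback_limit g)"
      by (intro eventually_mono[OF eventually_ge_at_top[of 0]])
    show "((\<lambda>s. exp (- (lam + \<alpha>) * t) * norm (pullback s g - pullback_limit g)) \<longlongrightarrow> 0) at_top"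
      using pullback_tendsto[OF g]
      by (intro tendsto_mult_right_zero tendsto_norm_zero) (simp add: LIM_zero)
  qed auto
  ultimately show ?thesis
    using tendsto_unique trivial_limit_at_top_linorder by metis
qed

text \<open>By invariance both values are propagated from time \<open>- T\<close>, where they are at
  most \<open>2 * radius\<close> apart. Only the forcing on the window \<open>{- T..0}\<close>
  enters, up to an exponentially small remainder.\<close>

lemma pullback_limit_dependence:
  assumes g: "g \<in> H" and h: "h \<in> H" and T: "T \<ge> 0"
    and d: "\<And>s. s \<in> {- T..0} \<Longrightarrow> norm (g s - h s) \<le> d"
  shows "(norm (pullback_limit g - pullback_limit h))\<^sup>2
      \<le> exp (- (lam + \<alpha>) * T) * (2 * radius)\<^sup>2 + (d / (lam + \<alpha>))\<^sup>2"
proof -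
  have eq: "pullback_limit k = \<phi> T (pullback_limit (shift (- T) k)) (shift (- T) k)" if "k \<in> H" for k
    using pullback_limit_invariant[OF translation_hull_shift[OF that] T, of "- T"]
    by (simp add: shift_shift)
  have "(norm (pullback_limit g - pullback_limit h))\<^sup>2
      \<le> exp (- (lam + \<alpha>) * T)
          * (norm (pullback_limit (shift (- T) g) - pullback_limit (shift (- T) h)))\<^sup>2 + (d / (lam + \<alpha>))\<^sup>2"
    using forcing_dependence[OF phi_solves[OF translation_hull_shift[OF g]]
        phi_solves[OF translation_hull_shift[OF h]] T, of "- T" "- T" d
        "pullback_limit (shift (- T) g)" "pullback_limit (shift (- T) h)"] d
    unfolding eq[OF g, symmetric] eq[OF h, symmetric]
      phi_0[OF translation_hull_shift[OF g]] phi_0[OF translation_hull_shift[OF h]]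
    by (simp add: shift_def)
  also have "\<dots> \<le> exp (- (lam + \<alpha>) * T) * (2 * radius)\<^sup>2 + (d / (lam + \<alpha>))\<^sup>2"
  proof -
    have "norm (pullback_limit (shift (- T) g) - pullback_limit (shift (- T) h)) \<le> 2 * radius"
      using norm_triangle_ineq4[of "pullback_limit (shift (- T) g)" "pullback_limit (shift (- T) h)"]
        norm_pullback_limit_le[OF translation_hull_shift[OF g, of "- T"]]
        norm_pullback_limit_le[OF translation_hull_shift[OF h, of "- T"]]
      by linarith
    then show ?thesis by (intro add_right_mono mult_left_mono power_mono) auto
  qed
  finally show ?thesis .
qed

lemma continuous_pullback_limit:
  "continuous_map (subtopology compact_open_topology H) euclidean pullback_limit"
  unfolding continuous_map_atin
proof (intro ballI)
  fix g assume "g \<in> topspace (subtopology compact_open_topology H)"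
  then have g: "g \<in> H" by simp
  show "limitin euclidean pullback_limit (pullback_limit g) (atin (subtopology compact_open_topology H) g)"
    unfolding limitin_canonical_iff
  proof (rule tendstoI)
    fix e :: real assume e: "e > 0"
    have k: "lam + \<alpha> > 0" using lam alpha by simp
    have "\<forall>\<^sub>F T in at_top. exp (- (lam + \<alpha>) * T) * (2 * radius)\<^sup>2 < e\<^sup>2 / 2"
      using e by (intro order_tendstoD(2)[OF decay]) simp
    then obtain N where N: "\<And>T. T \<ge> N \<Longrightarrow> exp (- (lam + \<alpha>) * T) * (2 * radius)\<^sup>2 < e\<^sup>2 / 2"
      unfolding eventually_at_top_linorder by blast
    \<comment> \<open>A window long enough to make the contribution of the remote past less than
      \<open>e\<^sup>2 / 2\<close>.\<close>
    define T where "T = max N 0"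
    have T: "T \<ge> 0" "exp (- (lam + \<alpha>) * T) * (2 * radius)\<^sup>2 < e\<^sup>2 / 2"
      using N[of T] by (simp_all add: T_def)
    \<comment> \<open>This choice gives the forcing term the value \<open>e\<^sup>2 / 4\<close>;
      closeness within \<open>d\<close> on the compact window is a neighbourhood condition.\<close>
    define d where "d = (lam + \<alpha>) * e / 2"
    have d_div: "d / (lam + \<alpha>) = e / 2" using nonzero_mult_div_cancel_left[of "lam + \<alpha>" "e / 2"] k by (simp add: d_def)
    have d: "d > 0" "(d / (lam + \<alpha>))\<^sup>2 \<le> e\<^sup>2 / 2"
      unfolding d_div using k e by (simp_all add: d_def power_divide)
    obtain V where V: "openin compact_open_topology V" "g \<in> V"
      "\<And>h t. h \<in> V \<Longrightarrow> t \<in> {- T..0} \<Longrightarrow> dist (h t) (g t) < d"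
      using compact_open_nhd_uniform[OF translation_hull_continuous[OF g] compact_Icc d(1)] by metis
    have "dist (pullback_limit h) (pullback_limit g) < e" if h: "h \<in> H \<inter> V" for h
    proof -
      have "(norm (pullback_limit h - pullback_limit g))\<^sup>2
          \<le> exp (- (lam + \<alpha>) * T) * (2 * radius)\<^sup>2 + (d / (lam + \<alpha>))\<^sup>2"
        using pullback_limit_dependence[of h g T d] h g T(1) V(3)[of h] by (force simp: dist_norm)
      also have "\<dots> < e\<^sup>2" using T(2) d(2) by simp
      finally show ?thesis using e by (simp add: dist_norm power2_less_imp_less)
    qed
    moreover have "openin (subtopology compact_open_topology H) (H \<inter> V)"
      using V(1) by (simp add: openin_subtopology_Int2)
    ultimately show "\<forall>\<^sub>F h in atin (subtopology compact_open_topology H) g.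
        dist (pullback_limit h) (pullback_limit g) < e"
      using V(2) g unfolding eventually_atin by blast
  qed
qed

lemma pullback_limit_attracts:
  assumes "g \<in> H" "t \<ge> 0"
  shows "norm (\<phi> t v g - pullback_limit (shift t g)) \<le> exp (- (lam + \<alpha>) * t) * norm (v - pullback_limit g)"
  using phi_contraction[OF assms, of v "pullback_limit g"] pullback_limit_invariant[OF assms] by simp

lemma pullback_limit_unique:
  assumes inv: "invariant_section f \<phi> \<gamma>'" and g: "g \<in> H"
  shows "\<gamma>' g = pullback_limit g"
proof -
  \<comment> \<open>Tolerance 1 is enough: continuity is needed only to bound
    \<open>\<gamma>'\<close> along the returning shifts.\<close>
  have "openin (subtopology compact_open_topology H)
      {h \<in> topspace (subtopology compact_open_topology H). \<gamma>' h \<in> ball (\<gamma>' g) 1}"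
    using inv unfolding invariant_section_def
    by (intro openin_continuous_map_preimage[where Y = euclidean]) auto
  then obtain W where W: "openin compact_open_topology W"
    "{h \<in> topspace (subtopology compact_open_topology H). \<gamma>' h \<in> ball (\<gamma>' g) 1} = W \<inter> H"
    unfolding openin_subtopology by blast
  have topH: "topspace (subtopology compact_open_topology H) = H"
    using translation_hull_continuous by (auto simp: topspace_compact_open_topology)
  have W_iff: "h \<in> W \<longleftrightarrow> dist (\<gamma>' g) (\<gamma>' h) < 1" if "h \<in> H" for h
    using that W(2)[unfolded topH set_eq_iff, rule_format, of h] by simp
  have "g \<in> W" using W_iff[OF g] by simp
  from compact_open_contains_uniform_ball[OF W(1) this] obtain e where e: "e > 0"
    "\<forall>h. continuous_on UNIV h \<longrightarrow> (\<forall>t. dist (h t) (g t) < e) \<longrightarrow> h \<in> W"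
    by (elim exE conjE) (rule that)
  \<comment> \<open>A bound on the distance of the two sections at any hull element in
    \<open>W\<close>: the first two terms control \<open>\<gamma>'\<close>, the last controls
    \<open>pullback_limit\<close>.\<close>
  let ?C = "norm (\<gamma>' g) + 1 + radius"
  have "norm (\<gamma>' g - pullback_limit g) \<le> 0"
  proof (rule ccontr)
    assume "\<not> ?thesis"
    with order_tendstoD(2)[OF decay[of ?C], of "norm (\<gamma>' g - pullback_limit g)"]
    obtain N where N: "\<And>s. s \<ge> N \<Longrightarrow>
        exp (- (lam + \<alpha>) * s) * ?C < norm (\<gamma>' g - pullback_limit g)"
      unfolding eventually_at_top_linorder by auto
    \<comment> \<open>A return so late that contraction from distance \<open>?C\<close> ends below
      the supposed positive gap.\<close>
    obtain \<tau> where \<tau>: "\<tau> \<ge> max N 0" "\<And>t. norm (shift (- \<tau>) g t - g t) < e"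
      using almost_periodic_hull_return[OF ap g e(1)] by blast
    let ?h = "shift (- \<tau>) g"
    have h: "?h \<in> H" by (rule translation_hull_shift[OF g])
    have "?h \<in> W" using e(2) translation_hull_continuous[OF h] \<tau>(2) by (simp add: dist_norm)
    then have "dist (\<gamma>' g) (\<gamma>' ?h) < 1" using W_iff[OF h] by simp
    then have "norm (\<gamma>' ?h) \<le> norm (\<gamma>' g) + 1"
      using norm_triangle_ineq2[of "\<gamma>' ?h" "\<gamma>' g"] by (simp add: dist_norm norm_minus_commute)
    then have C: "norm (\<gamma>' ?h - pullback_limit ?h) \<le> ?C"
      using norm_triangle_ineq4[of "\<gamma>' ?h" "pullback_limit ?h"] norm_pullback_limit_le[OF h] by linarith
    \<comment> \<open>Running forward for time \<tau> undoes the backward shift, so both sections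
      are compared at \<open>g\<close> itself.\<close>
    have "\<phi> \<tau> (\<gamma>' ?h) ?h = \<gamma>' g"
      using inv h \<tau>(1) unfolding invariant_section_def by (simp add: shift_shift)
    then have "norm (\<gamma>' g - pullback_limit g)
        \<le> exp (- (lam + \<alpha>) * \<tau>) * norm (\<gamma>' ?h - pullback_limit ?h)"
      using pullback_limit_attracts[OF h, of \<tau> "\<gamma>' ?h"] \<tau>(1) by (simp add: shift_shift)
    also have "\<dots> \<le> exp (- (lam + \<alpha>) * \<tau>) * ?C" using C by (intro mult_left_mono) auto
    finally show False using N[of \<tau>] \<tau>(1) by simp
  qed
  then show ?thesis by simp
qed

end

theorem theorem5p8:
  fixes \<nu> lam \<alpha> :: real
    and f :: "real \<Rightarrow> ell2"
    and F :: "real \<Rightarrow> real"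
    and \<phi> :: "real \<Rightarrow> ell2 \<Rightarrow> (real \<Rightarrow> ell2) \<Rightarrow> ell2"
  assumes "\<nu> > 0" and "lam > 0" and "\<alpha> \<ge> 0"
    and "almost_periodic f"
    and "continuous_on UNIV F" and "lipschitz_on_bounded_sets F" and "F 0 = 0"
    and "\<And>x1 x2. (x1 - x2) * (F x1 - F x2) \<le> - \<alpha> * \<bar>x1 - x2\<bar>\<^sup>2"
    and "generated_cocycle \<nu> lam F f \<phi>"
  shows "\<exists>\<gamma>. invariant_section f \<phi> \<gamma> \<and>
           (\<forall>\<gamma>'. invariant_section f \<phi> \<gamma>' \<longrightarrow> (\<forall>g\<in>translation_hull f. \<gamma>' g = \<gamma> g)) \<and>
           (\<forall>t\<ge>0. \<forall>v. \<forall>g\<in>translation_hull f.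
              norm (\<phi> t v g - \<gamma> (shift t g)) \<le> exp (- (lam + \<alpha>) * t) * norm (v - \<gamma> g))"
proof -
  interpret dissipative_lattice_cocycle \<nu> lam \<alpha> F f \<phi>
    using assms by unfold_locales
  show ?thesis
  proof (intro exI[of _ pullback_limit] conjI allI impI ballI)
    show "invariant_section f \<phi> pullback_limit"
      unfolding invariant_section_def
      using continuous_pullback_limit pullback_limit_invariant by simp
  qed (simp_all only: pullback_limit_unique pullback_limit_attracts)
qed

end
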